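(* Let $(\mathcal V,\mathcal L,\{\mathcal L_v\}_{v\in\mathcal V},\theta)$ be a feasible instance of the linear assignment problem (LAP) and let $(\alpha,\beta)$ be feasible for its dual linear program (D). Then: (a) $(\alpha,\beta)$ is optimal for (D) if and only if the equality subgraph $(\mathcal V\cup\mathcal L,\mathcal E(\alpha,\beta))$ has a perfect matching; (b) $(\alpha,\beta)$ is in the relative interior of the set of optimizers of (D) if and only if the equality subgraph $(\mathcal V\cup\mathcal L,\mathcal E(\alpha,\beta))$ has a perfect matching and each edge of the equality subgraph is perfectly matchable.
   Context: **LAP.** $\mathcal V$ (vertices) and $\mathcal L$ (labels) are finite disjoint sets with $|\mathcal V|=|\mathcal L|$. For each $v\in\mathcal V$, $\mathcal L_v\subseteq\mathcal L$ is the set of allowed labels and $\theta_v\colon\mathcal L_v\to\mathbb R$ is a cost function. A feasible assignment is a bijection $x\colon\mathcal V\to\mathcal L$ (written $v\mapsto x_v$) with $x_v\in\mathcal L_v$ for all $v$; the LAP minimizes $\sum_{v\in\mathcal V}\theta_v(x_v)$ over feasible assignments. The LAP is assumed feasible. **Dual LP (D).** Maximize $\sum_{v\in\mathcal V}\alpha_v+\sum_{\ell\in\mathcal L}\beta_\ell$ over $\alpha\in\mathbb R^{\mathcal V}$, $\beta\in\mathbb R^{\mathcal L}$ subject to $\alpha_v+\beta_\ell\le\theta_v(\ell)$ for all $v\in\mathcal V$, $\ell\in\mathcal L_v$. **Equality subgraph.** The bipartite graph $(\mathcal V\cup\mathcal L,\mathcal E(\alpha,\beta))$ with $\mathcal E(\alpha,\beta)=\{\{v,\ell\}\mid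 v\in\mathcal V,\ \ell\in\mathcal L_v,\ \alpha_v+\beta_\ell=\theta_v(\ell)\}$. **Matchings.** A perfect matching in a bipartite graph $(\mathcal V\cup\mathcal L,\mathcal E)$ is a bijection $x\colon\mathcal V\to\mathcal L$ with $\{v,x_v\}\in\mathcal E$ for all $v\in\mathcal V$. An edge $\{v,\ell\}\in\mathcal E$ is perfectly matchable if there is a perfect matching $x$ with $x_v=\ell$. *)

theory Defs
  imports "HOL-Analysis.Analysis"
begin

text \<open>
  The finite sets of vertices and labels are the (disjoint) universes of two finite types
  \<open>'v\<close> and \<open>'l\<close>. An instance is given by the allowed labels \<open>Lab v\<close> and costs \<open>\<theta> v l\<close>; the
  values of \<open>\<theta> v\<close> outside \<open>Lab v\<close> are never used.
\<close>

definition feasible_assignment :: "('v::finite \<Rightarrow> 'l::finite set) \<Rightarrow> ('v \<Rightarrow> 'l) \<Rightarrow> bool" where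
  "feasible_assignment Lab x \<longleftrightarrow> bij x \<and> (\<forall>v. x v \<in> Lab v)"

definition lap_feasible :: "('v::finite \<Rightarrow> 'l::finite set) \<Rightarrow> bool" where
  "lap_feasible Lab \<longleftrightarrow> (\<exists>x. feasible_assignment Lab x)"

definition dual_feasible ::
  "('v::finite \<Rightarrow> 'l::finite set) \<Rightarrow> ('v \<Rightarrow> 'l \<Rightarrow> real) \<Rightarrow> ((real ^ 'v) \<times> (real ^ 'l)) set" where
  "dual_feasible Lab \<theta> = {(\<alpha>, \<beta>). \<forall>v. \<forall>l\<in>Lab v. \<alpha> $ v + \<beta> $ l \<le> \<theta> v l}"

definition dual_objective :: "(real ^ 'v::finite) \<times> (real ^ 'l::finite) \<Rightarrow> real" where
  "dual_objective = (\<lambda>(\<alpha>, \<beta>). (\<Sum>v\<in>UNIV. \<alpha> $ v) + (\<Sum>l\<in>UNIV. \<beta> $ l))"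

definition dual_optimizers ::
  "('v::finite \<Rightarrow> 'l::finite set) \<Rightarrow> ('v \<Rightarrow> 'l \<Rightarrow> real) \<Rightarrow> ((real ^ 'v) \<times> (real ^ 'l)) set" where
  "dual_optimizers Lab \<theta> =
     {p \<in> dual_feasible Lab \<theta>. \<forall>q\<in>dual_feasible Lab \<theta>. dual_objective q \<le> dual_objective p}"

text \<open>
  Bipartite graphs have node set \<open>UNIV :: ('v + 'l) set\<close> and are given by their set of
  undirected edges \<open>{Inl v, Inr l}\<close>.
\<close>

definition equality_edges ::
  "('v::finite \<Rightarrow> 'l::finite set) \<Rightarrow> ('v \<Rightarrow> 'l \<Rightarrow> real) \<Rightarrow> real ^ 'v \<Rightarrow> real ^ 'l
    \<Rightarrow> ('v + 'l) set set" where
  "equality_edges Lab \<theta> \<alpha> \<beta> = {{Inl v, Inr l} | v l. l \<in> Lab v \<and> \<alpha> $ v + \<beta> $ l = \<theta> v l}"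

definition perfect_matching :: "('v + 'l) set set \<Rightarrow> ('v \<Rightarrow> 'l) \<Rightarrow> bool" where
  "perfect_matching E x \<longleftrightarrow> bij x \<and> (\<forall>v. {Inl v, Inr (x v)} \<in> E)"

definition perfectly_matchable :: "('v + 'l) set set \<Rightarrow> ('v + 'l) set \<Rightarrow> bool" where
  "perfectly_matchable E e \<longleftrightarrow>
     e \<in> E \<and> (\<exists>v l x. e = {Inl v, Inr l} \<and> perfect_matching E x \<and> x v = l)"

end

theory Submission
  imports Defs
begin

text \<open>
  Both parts rest on one move: raise \<open>\<alpha>\<close> by \<open>\<epsilon>\<close> on a set \<open>X\<close> of vertices and lower \<open>\<beta>\<close> by \<open>\<epsilon>\<close> on
  the set \<open>N(X)\<close> of its neighbours in the equality subgraph. For small \<open>\<epsilon>\<close> this preserves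
  feasibility and changes the objective by \<open>\<epsilon> (|X| - |N(X)|)\<close>. If there is no perfect matching, Hall's
  theorem yields \<open>X\<close> with \<open>|N(X)| < |X|\<close>, so the move improves the objective. If an edge \<open>{v, \<ell>}\<close>
  is not perfectly matchable at an optimal point, Hall's theorem for the graph without \<open>v\<close> and \<open>\<ell>\<close>
  yields \<open>X\<close> with \<open>v \<notin> X\<close>, \<open>\<ell> \<in> N(X)\<close> and \<open>|N(X)| = |X|\<close>; the move then leads to
  another optimizer, but the opposite move violates the constraint of \<open>{v, \<ell>}\<close>, so the point is
  not in the relative interior. Conversely, by complementary slackness all optimizers are tight on
  every perfectly matchable edge, so if all edges are such, only constraints that are strict at
  \<open>(\<alpha>, \<beta>)\<close> restrict the optimizers near \<open>(\<alpha>, \<beta>)\<close> within their affine hull.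
\<close>

section \<open>Two general tools: Hall's theorem and prolongation at relative interior
  points\<close>

theorem Hall_marriage:
  assumes "finite I" and "\<And>i. i \<in> I \<Longrightarrow> finite (A i)"
    and "\<And>S. S \<subseteq> I \<Longrightarrow> card S \<le> card (\<Union>(A ` S))"
  shows "\<exists>f. inj_on f I \<and> (\<forall>i\<in>I. f i \<in> A i)"
  using assms
proof (induction I arbitrary: A rule: finite_psubset_induct)
  case (psubset I)
  have fin: "finite (\<Union>(A ` S))" if "S \<subseteq> I" for S
    using that psubset.hyps psubset.prems(1) by (auto intro: finite_subset)
  show ?case
  \<comment> \<open>Either some nonempty proper \<open>S\<close> is critical, and \<open>S\<close>
    and \<open>I - S\<close> can be matched separately, or every such set has an element to
    spare.\<close>
  proof (cases "\<exists>S. S \<subset> I \<and> S \<noteq> {} \<and> card (\<Union>(A ` S)) \<le> card S")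
    case True
    then obtain S where S: "S \<subset> I" "S \<noteq> {}" "card (\<Union>(A ` S)) \<le> card S"
      by blast
    let ?U = "\<Union>(A ` S)"
    have finS: "finite S"
      using S(1) psubset.hyps by (auto intro: finite_subset)
    have "\<exists>f. inj_on f S \<and> (\<forall>i\<in>S. f i \<in> A i)"
      using S(1) by (intro psubset.IH psubset.prems) auto
    then obtain f where f: "inj_on f S" "\<forall>i\<in>S. f i \<in> A i"
      by blast
    \<comment> \<open>Hall's condition survives the removal of \<open>?U\<close>: apply it to
      \<open>T \<union> S\<close> and discount \<open>?U\<close>, which has at most
      \<open>card S\<close> elements.\<close>
    have "\<exists>g. inj_on g (I - S) \<and> (\<forall>i\<in>I - S. g i \<in> A i - ?U)"
    proof (rule psubset.IH)
      show "I - S \<subset> I"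
        using S by auto
      show "finite (A i - ?U)" if "i \<in> I - S" for i
        using that psubset.prems(1) by auto
      fix T assume T: "T \<subseteq> I - S"
      then have "finite T"
        using psubset.hyps by (auto intro: finite_subset)
      then have "card T + card S = card (T \<union> S)"
        using T finS by (subst card_Un_disjoint) auto
      also have "\<dots> \<le> card (\<Union>(A ` (T \<union> S)))"
        using T S(1) by (intro psubset.prems(2)) auto
      also have "\<Union>(A ` (T \<union> S)) = (\<Union>i\<in>T. A i - ?U) \<union> ?U"
        by auto
      also have "card \<dots> \<le> card (\<Union>i\<in>T. A i - ?U) + card ?U"
        by (rule card_Un_le)
      finally show "card T \<le> card (\<Union>i\<in>T. A i - ?U)"
        using S(3) by linarith
    qed
    then obtain g where g: "inj_on g (I - S)" "\<forall>i\<in>I - S. g i \<in> A i - ?U"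
      by blast
    have "inj_on (\<lambda>i. if i \<in> S then f i else g i) I"
      unfolding inj_on_def
    proof (intro ballI impI)
      fix i j
      assume "i \<in> I" "j \<in> I" "(if i \<in> S then f i else g i) = (if j \<in> S then f j else g j)"
      moreover have "f a \<noteq> g b" if "a \<in> S" "b \<in> I - S" for a b
        using f(2) g(2) that by force
      ultimately show "i = j"
        using f(1) g(1) by (auto simp: inj_on_def split: if_splits) metis
    qed
    moreover have "\<forall>i\<in>I. (if i \<in> S then f i else g i) \<in> A i"
      using f(2) g(2) by auto
    ultimately show ?thesis
      by blast
  next
    case strict: False
    show ?thesis
    proof (cases "I = {}")
      case False
      then obtain i where i: "i \<in> I"
        by blast
      have "card {i} \<le> card (\<Union>(A ` {i}))"
        using i by (intro psubset.prems) auto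
      then obtain a where a: "a \<in> A i"
        by fastforce
      \<comment> \<open>Reserving \<open>a\<close> for \<open>i\<close> costs each union at most one
        element, which the strict inequality allows.\<close>
      have "\<exists>f. inj_on f (I - {i}) \<and> (\<forall>j\<in>I - {i}. f j \<in> A j - {a})"
      proof (rule psubset.IH)
        show "I - {i} \<subset> I"
          using i by auto
        show "finite (A j - {a})" if "j \<in> I - {i}" for j
          using that psubset.prems(1) by auto
        fix S assume S: "S \<subseteq> I - {i}"
        show "card S \<le> card (\<Union>j\<in>S. A j - {a})"
        proof (cases "S = {}")
          case False
          then have "card S < card (\<Union>(A ` S))"
            using strict S i by (metis Diff_empty not_le psubsetI subset_Diff_insert)
          moreover have "(\<Union>j\<in>S. A j - {a}) = \<Union>(A ` S) - {a}"
            by auto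
          ultimately show ?thesis
            using card_Diff1_le[of "\<Union>(A ` S)" a] fin[of S] S
            by (auto simp: card_Diff_singleton_if)
        qed simp
      qed
      then obtain f where f: "inj_on f (I - {i})" "\<forall>j\<in>I - {i}. f j \<in> A j - {a}"
        by blast
      have "inj_on (f(i := a)) I"
        using f unfolding inj_on_def by (metis DiffI Diff_iff empty_iff fun_upd_apply insert_iff)
      moreover have "\<forall>j\<in>I. (f(i := a)) j \<in> A j"
        using f(2) a by auto
      ultimately show ?thesis
        by blast
    qed simp
  qed
qed

text \<open>The line through \<open>p\<close> and \<open>q\<close> lies in the affine hull, so the
  segment from \<open>q\<close> to \<open>p\<close> can be prolonged past \<open>p\<close> inside a
  small ball. This is what turns a move away from \<open>p\<close> into its opposite.\<close>

lemma rel_interior_extend_beyond: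
  fixes p q :: "'a::euclidean_space"
  assumes p: "p \<in> rel_interior S" and q: "q \<in> S"
  shows "\<exists>d>0. p + d *\<^sub>R (p - q) \<in> S"
proof -
  obtain e where e: "e > 0" "ball p e \<inter> affine hull S \<subseteq> S" and pS: "p \<in> S"
    using p by (auto simp: mem_rel_interior_ball)
  \<comment> \<open>The \<open>+ 1\<close> keeps the denominator positive when
    \<open>p = q\<close>.\<close>
  define d where "d = e / (2 * (norm (p - q) + 1))"
  have d: "d > 0"
    using e(1) unfolding d_def by (intro divide_pos_pos) (auto intro: add_nonneg_pos)
  have "d * norm (p - q) < d * (2 * (norm (p - q) + 1))"
    using d by (intro mult_strict_left_mono) (auto intro: add_nonneg_pos simp: distrib_left)
  also have "\<dots> = e"
    using norm_ge_zero[of "p - q"] unfolding d_def by (simp add: add_nonneg_eq_0_iff)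
  finally have "p + d *\<^sub>R (p - q) \<in> ball p e"
    using d by (simp add: dist_norm)
  moreover have "(1 + d) *\<^sub>R p + (- d) *\<^sub>R q \<in> affine hull S"
    using pS q by (intro mem_affine[OF affine_affine_hull]) (auto intro: hull_inc)
  then have "p + d *\<^sub>R (p - q) \<in> affine hull S"
    by (simp add: algebra_simps)
  ultimately show ?thesis
    using e(2) d by blast
qed

section \<open>The equality subgraph as a family of neighbourhoods, the form that Hall's theorem
  takes\<close>

definition tight_labels ::
  "('v::finite \<Rightarrow> 'l::finite set) \<Rightarrow> ('v \<Rightarrow> 'l \<Rightarrow> real) \<Rightarrow> (real ^ 'v) \<times> (real ^ 'l) \<Rightarrow> 'v \<Rightarrow> 'l set"
  where "tight_labels Lab \<theta> p v = {l \<in> Lab v. fst p $ v + snd p $ l = \<theta> v l}"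

lemma mem_equality_edges:
  "{Inl v, Inr l} \<in> equality_edges Lab \<theta> \<alpha> \<beta> \<longleftrightarrow> l \<in> tight_labels Lab \<theta> (\<alpha>, \<beta>) v"
  by (auto simp: equality_edges_def tight_labels_def doubleton_eq_iff)

lemma perfect_matching_equality_edges:
  "perfect_matching (equality_edges Lab \<theta> \<alpha> \<beta>) x \<longleftrightarrow>
     bij x \<and> (\<forall>v. x v \<in> tight_labels Lab \<theta> (\<alpha>, \<beta>) v)"
  by (simp add: perfect_matching_def mem_equality_edges)

lemma all_perfectly_matchable_equality_edges:
  "(\<forall>e\<in>equality_edges Lab \<theta> \<alpha> \<beta>. perfectly_matchable (equality_edges Lab \<theta> \<alpha> \<beta>) e) \<longleftrightarrow>
     (\<forall>v. \<forall>l\<in>tight_labels Lab \<theta> (\<alpha>, \<beta>) v.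
        \<exists>x. bij x \<and> (\<forall>w. x w \<in> tight_labels Lab \<theta> (\<alpha>, \<beta>) w) \<and> x v = l)"
  (is "?L = ?R")
proof
  assume L: ?L
  show ?R
  proof (intro allI ballI)
    fix v l assume "l \<in> tight_labels Lab \<theta> (\<alpha>, \<beta>) v"
    then have "perfectly_matchable (equality_edges Lab \<theta> \<alpha> \<beta>) {Inl v, Inr l}"
      using L by (simp add: mem_equality_edges)
    then show "\<exists>x. bij x \<and> (\<forall>w. x w \<in> tight_labels Lab \<theta> (\<alpha>, \<beta>) w) \<and> x v = l"
      by (auto simp: perfectly_matchable_def perfect_matching_equality_edges doubleton_eq_iff)
  qed
next
  assume R: ?R
  show ?L
  proof
    fix e assume e: "e \<in> equality_edges Lab \<theta> \<alpha> \<beta>"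
    then obtain v l where vl: "e = {Inl v, Inr l}"
      by (auto simp: equality_edges_def)
    then have "l \<in> tight_labels Lab \<theta> (\<alpha>, \<beta>) v"
      using e by (simp add: mem_equality_edges)
    then obtain x where
      "bij x" "\<forall>w. x w \<in> tight_labels Lab \<theta> (\<alpha>, \<beta>) w" "x v = l"
      using R by blast
    then show "perfectly_matchable (equality_edges Lab \<theta> \<alpha> \<beta>) e"
      using e vl unfolding perfectly_matchable_def perfect_matching_equality_edges by blast
  qed
qed

section \<open>Weak duality and complementary slackness\<close>

lemma dual_feasible_iff:
  "p \<in> dual_feasible Lab \<theta> \<longleftrightarrow> (\<forall>v. \<forall>l\<in>Lab v. fst p $ v + snd p $ l \<le> \<theta> v l)"
  by (cases p) (simp add: dual_feasible_def)

lemma dual_objective_eq: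
  "dual_objective p = (\<Sum>v\<in>UNIV. fst p $ v) + (\<Sum>l\<in>UNIV. snd p $ l)"
  by (cases p) (simp add: dual_objective_def)

text \<open>Reindexing the \<beta> sum along \<open>x\<close> turns the objective into a sum of
  left-hand sides of dual constraints, which can be compared termwise with the cost of
  \<open>x\<close>.\<close>

lemma dual_objective_bij:
  assumes "bij x"
  shows "dual_objective p = (\<Sum>v\<in>UNIV. fst p $ v + snd p $ x v)"
proof -
  have "(\<Sum>v\<in>UNIV. snd p $ x v) = (\<Sum>l\<in>UNIV. snd p $ l)"
    using sum.reindex_bij_betw[OF assms] by simp
  then show ?thesis
    by (simp add: dual_objective_eq sum.distrib)
qed

lemma dual_objective_le_cost:
  assumes "q \<in> dual_feasible Lab \<theta>" "bij x" "\<And>v. x v \<in> Lab v"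
  shows "dual_objective q \<le> (\<Sum>v\<in>UNIV. \<theta> v (x v))"
  unfolding dual_objective_bij[OF assms(2)]
  using assms(1,3) by (intro sum_mono) (simp add: dual_feasible_iff)

text \<open>The duality gap is a sum of nonnegative slacks, so it vanishes exactly when each slack
  does.\<close>

lemma dual_objective_eq_cost_iff:
  assumes "q \<in> dual_feasible Lab \<theta>" "bij x" "\<And>v. x v \<in> Lab v"
  shows "dual_objective q = (\<Sum>v\<in>UNIV. \<theta> v (x v)) \<longleftrightarrow> (\<forall>v. x v \<in> tight_labels Lab \<theta> q v)"
proof -
  have "dual_objective q = (\<Sum>v\<in>UNIV. \<theta> v (x v)) \<longleftrightarrow>
      (\<Sum>v\<in>UNIV. \<theta> v (x v) - (fst q $ v + snd q $ x v)) = 0"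
    by (auto simp: dual_objective_bij[OF assms(2)] sum_subtractf)
  also have "\<dots> \<longleftrightarrow> (\<forall>v. \<theta> v (x v) - (fst q $ v + snd q $ x v) = 0)"
    using assms by (subst sum_nonneg_eq_0_iff) (auto simp: dual_feasible_iff)
  also have "\<dots> \<longleftrightarrow> (\<forall>v. x v \<in> tight_labels Lab \<theta> q v)"
    using assms(3) by (auto simp: tight_labels_def)
  finally show ?thesis .
qed

lemma dual_optimal_if_tight_matching:
  assumes "p \<in> dual_feasible Lab \<theta>" "bij x" "\<And>v. x v \<in> tight_labels Lab \<theta> p v"
  shows "p \<in> dual_optimizers Lab \<theta>"
proof -
  have L: "x v \<in> Lab v" for v
    using assms(3)[of v] by (simp add: tight_labels_def)
  have "dual_objective p = (\<Sum>v\<in>UNIV. \<theta> v (x v))"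
    using dual_objective_eq_cost_iff[OF assms(1,2) L] assms(3) by blast
  then show ?thesis
    using dual_objective_le_cost[OF _ assms(2) L] assms(1) by (simp add: dual_optimizers_def)
qed

text \<open>The cost of \<open>x\<close> bounds every dual objective and is attained at
  \<open>p\<close>, hence also at \<open>q\<close>; complementary slackness then applies to
  \<open>q\<close>.\<close>

lemma dual_optimizer_tight_on_matching:
  assumes "p \<in> dual_feasible Lab \<theta>" "bij x" "\<And>v. x v \<in> tight_labels Lab \<theta> p v"
    and "q \<in> dual_optimizers Lab \<theta>"
  shows "x v \<in> tight_labels Lab \<theta> q v"
proof -
  have L: "x v \<in> Lab v" for v
    using assms(3)[of v] by (simp add: tight_labels_def)
  have q: "q \<in> dual_feasible Lab \<theta>" "dual_objective p \<le> dual_objective q"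
    using assms(1,4) by (auto simp: dual_optimizers_def)
  have "dual_objective p = (\<Sum>v\<in>UNIV. \<theta> v (x v))"
    using dual_objective_eq_cost_iff[OF assms(1,2) L] assms(3) by blast
  then have "dual_objective q = (\<Sum>v\<in>UNIV. \<theta> v (x v))"
    using q dual_objective_le_cost[OF q(1) assms(2) L] by linarith
  then show ?thesis
    using dual_objective_eq_cost_iff[OF q(1) assms(2) L] by blast
qed

section \<open>The shift along a vertex set and its neighbourhood\<close>

definition shift_direction ::
  "'v::finite set \<Rightarrow> 'l::finite set \<Rightarrow> (real ^ 'v) \<times> (real ^ 'l)" where
  "shift_direction X Y = ((\<chi> v. if v \<in> X then 1 else 0), (\<chi> l. if l \<in> Y then - 1 else 0))"

lemma dual_objective_shift:
  "dual_objective (p + c *\<^sub>R shift_direction X Y) =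
     dual_objective p + c * (real (card X) - real (card Y))"
proof -
  have "(\<Sum>v\<in>UNIV. if v \<in> X then 1 else 0 :: real) = real (card X)"
    by (simp flip: sum.inter_filter add: sum.If_cases)
  moreover have "(\<Sum>l\<in>UNIV. if l \<in> Y then - 1 else 0 :: real) = - real (card Y)"
    by (simp add: sum.If_cases)
  ultimately show ?thesis
    by (simp add: dual_objective_eq shift_direction_def sum.distrib algebra_simps
        flip: sum_distrib_left)
qed

text \<open>A left-hand side grows only for a vertex in \<open>X\<close> and a label outside its
  neighbourhood, and such a constraint is strict at \<open>p\<close>.\<close>

lemma dual_feasible_shift:
  assumes p: "p \<in> dual_feasible Lab \<theta>"
  shows "\<exists>c>0. p + c *\<^sub>R shift_direction X (\<Union>(tight_labels Lab \<theta> p ` X)) \<in> dual_feasible Lab \<theta>"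
proof -
  let ?N = "\<Union>(tight_labels Lab \<theta> p ` X)"
  let ?s = "\<lambda>(v, l). \<theta> v l - (fst p $ v + snd p $ l)"
  define K where "K = {(v, l). l \<in> Lab v - tight_labels Lab \<theta> p v}"
  \<comment> \<open>The least slack of a non-tight constraint; the inserted 1 covers the case that
    there is none.\<close>
  define c where "c = Min (insert 1 (?s ` K))"
  have "?s k > 0" if "k \<in> K" for k
    using that p by (fastforce simp: K_def tight_labels_def dual_feasible_iff order_less_le)
  then have c: "c > 0"
    by (auto simp: c_def)
  have slack: "fst p $ v + snd p $ l + c \<le> \<theta> v l" if "l \<in> Lab v" "l \<notin> tight_labels Lab \<theta> p v" for v l
  proof -
    have "c \<le> ?s (v, l)"
      unfolding c_def using that by (intro Min_le) (auto simp: K_def)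
    then show ?thesis
      by simp
  qed
  have "p + c *\<^sub>R shift_direction X ?N \<in> dual_feasible Lab \<theta>"
    unfolding dual_feasible_iff
  proof (intro allI ballI)
    fix v l assume l: "l \<in> Lab v"
    have "fst p $ v + snd p $ l \<le> \<theta> v l"
      using p l by (simp add: dual_feasible_iff)
    then show "fst (p + c *\<^sub>R shift_direction X ?N) $ v + snd (p + c *\<^sub>R shift_direction X ?N) $ l
        \<le> \<theta> v l"
      using c l slack[of l v] by (auto simp: shift_direction_def)
  qed
  then show ?thesis
    using c by blast
qed

text \<open>Hall's condition at an optimizer: with fewer neighbours than vertices, the shift would
  raise the objective.\<close>

lemma dual_optimizer_card_le:
  assumes "p \<in> dual_optimizers Lab \<theta>"
  shows "card X \<le> card (\<Union>(tight_labels Lab \<theta> p ` X))"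
proof -
  let ?N = "\<Union>(tight_labels Lab \<theta> p ` X)"
  have "p \<in> dual_feasible Lab \<theta>"
    using assms by (simp add: dual_optimizers_def)
  then obtain c where c: "c > 0" "p + c *\<^sub>R shift_direction X ?N \<in> dual_feasible Lab \<theta>"
    using dual_feasible_shift by blast
  then have "dual_objective p + c * (real (card X) - real (card ?N)) \<le> dual_objective p"
    using assms unfolding dual_objective_shift[symmetric] by (simp add: dual_optimizers_def)
  then show ?thesis
    using c(1) by (simp add: mult_le_0_iff)
qed

section \<open>Tight matchings at optimizers\<close>

lemma inj_imp_bij_card_eq:
  fixes x :: "'a::finite \<Rightarrow> 'b::finite"
  assumes "CARD('a) = CARD('b)" "inj x"
  shows "bij x"
proof -
  have "card (range x) = CARD('b)"
    using assms by (simp add: card_image)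
  then have "range x = UNIV"
    by (intro card_subset_eq) auto
  then show ?thesis
    using assms(2) by (simp add: bij_def)
qed

lemma dual_optimizer_tight_matching:
  fixes Lab :: "'v::finite \<Rightarrow> 'l::finite set"
  assumes "CARD('v) = CARD('l)" "p \<in> dual_optimizers Lab \<theta>"
  shows "\<exists>x. bij x \<and> (\<forall>v. x v \<in> tight_labels Lab \<theta> p v)"
proof -
  have "\<exists>x. inj_on x UNIV \<and> (\<forall>v\<in>UNIV. x v \<in> tight_labels Lab \<theta> p v)"
    by (intro Hall_marriage dual_optimizer_card_le assms) auto
  then show ?thesis
    using inj_imp_bij_card_eq[OF assms(1)] by blast
qed

section \<open>The relative interior of the set of optimizers\<close>

lemma rel_interior_dual_optimizers_tight_matching:
  fixes Lab :: "'v::finite \<Rightarrow> 'l::finite set"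
  assumes card_eq: "CARD('v) = CARD('l)" and p: "p \<in> rel_interior (dual_optimizers Lab \<theta>)"
    and l: "l \<in> tight_labels Lab \<theta> p v"
  shows "\<exists>x. bij x \<and> (\<forall>w. x w \<in> tight_labels Lab \<theta> p w) \<and> x v = l"
proof -
  let ?T = "tight_labels Lab \<theta> p"
  have opt: "p \<in> dual_optimizers Lab \<theta>"
    using p rel_interior_subset by blast
  then have feas: "p \<in> dual_feasible Lab \<theta>"
    by (simp add: dual_optimizers_def)
  \<comment> \<open>The pair \<open>v\<close>, \<open>l\<close> is set aside and the other vertices
    are matched without \<open>l\<close>.\<close>
  have "\<exists>x. inj_on x (- {v}) \<and> (\<forall>w\<in>- {v}. x w \<in> ?T w - {l})"
  proof (rule Hall_marriage)
    fix X assume X: "X \<subseteq> - {v}"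
    let ?N = "\<Union>(?T ` X)"
    let ?d = "shift_direction X ?N"
    have eq: "(\<Union>w\<in>X. ?T w - {l}) = ?N - {l}"
      by auto
    have le: "card X \<le> card ?N"
      by (rule dual_optimizer_card_le[OF opt])
    \<comment> \<open>Deleting \<open>l\<close> costs at most one neighbour, so Hall's condition can
      fail only if \<open>X\<close> has exactly \<open>card X\<close> neighbours and
      \<open>l\<close> is one of them.\<close>
    have "l \<notin> ?N" if card_N: "card ?N = card X"
    proof
      assume lN: "l \<in> ?N"
      obtain c where c: "c > 0" "p + c *\<^sub>R ?d \<in> dual_feasible Lab \<theta>"
        using dual_feasible_shift[OF feas] by blast
      \<comment> \<open>Equal cardinalities leave the objective unchanged.\<close>
      then have "p + c *\<^sub>R ?d \<in> dual_optimizers Lab \<theta>"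
        using opt card_N by (simp add: dual_optimizers_def dual_objective_shift)
      then obtain d where d: "d > 0"
        "p + d *\<^sub>R (p - (p + c *\<^sub>R ?d)) \<in> dual_optimizers Lab \<theta>"
        using rel_interior_extend_beyond[OF p] by blast
      let ?q = "p + d *\<^sub>R (p - (p + c *\<^sub>R ?d))"
      have vX: "l \<in> Lab v" "v \<notin> X"
        using l X by (auto simp: tight_labels_def)
      then have "fst ?q $ v + snd ?q $ l \<le> \<theta> v l"
        using d(2) by (simp only: dual_optimizers_def dual_feasible_iff mem_Collect_eq)
      \<comment> \<open>The reversed shift raises \<beta> at \<open>l\<close> but leaves \<alpha> at
        \<open>v\<close> alone, breaking a constraint that was already tight.\<close>
      moreover have "fst ?q $ v = fst p $ v" "snd ?q $ l = snd p $ l + d * c"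
        using vX(2) lN by (simp_all add: shift_direction_def)
      moreover have "fst p $ v + snd p $ l = \<theta> v l"
        using l by (simp add: tight_labels_def)
      ultimately have "d * c \<le> 0"
        by linarith
      then show False
        using c(1) d(1) by (simp add: mult_le_0_iff)
    qed
    then show "card X \<le> card (\<Union>w\<in>X. ?T w - {l})"
      unfolding eq using le by (cases "card ?N = card X") (auto simp: card_Diff_singleton_if)
  qed auto
  then obtain x where x: "inj_on x (- {v})" "\<forall>w\<in>- {v}. x w \<in> ?T w - {l}"
    by blast
  have "inj (x(v := l))"
    using x unfolding inj_on_def
    by (metis ComplI DiffD2 fun_upd_other fun_upd_same singletonD singletonI)
  then have "bij (x(v := l))"
    using inj_imp_bij_card_eq[OF card_eq] by blast
  then show ?thesis
    using x(2) l by (intro exI[of _ "x(v := l)"]) auto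
qed

lemma rel_interior_dual_optimizers_if_matchable:
  assumes p: "p \<in> dual_optimizers Lab \<theta>"
    and m: "\<And>v l. l \<in> tight_labels Lab \<theta> p v \<Longrightarrow>
      \<exists>x. bij x \<and> (\<forall>w. x w \<in> tight_labels Lab \<theta> p w) \<and> x v = l"
    and y: "bij y" "\<And>v. y v \<in> tight_labels Lab \<theta> p v"
  shows "p \<in> rel_interior (dual_optimizers Lab \<theta>)"
proof -
  let ?T = "tight_labels Lab \<theta> p"
  \<comment> \<open>An affine set that contains all optimizers, since every edge tight at
    \<open>p\<close> lies in a tight matching; hence it contains their affine hull.\<close>
  define H where "H = {q. \<forall>v. \<forall>l\<in>?T v. fst q $ v + snd q $ l = \<theta> v l}"
  \<comment> \<open>The constraints strict at \<open>p\<close> cut out an open neighbourhood of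
    \<open>p\<close>; within \<open>H\<close> they are the only ones left to check.\<close>
  define U where "U = (\<Inter>v. \<Inter>l\<in>Lab v - ?T v. {q. fst q $ v + snd q $ l < \<theta> v l})"
  have feas: "p \<in> dual_feasible Lab \<theta>"
    using p by (simp add: dual_optimizers_def)
  have "dual_optimizers Lab \<theta> \<subseteq> H"
  proof
    fix q assume q: "q \<in> dual_optimizers Lab \<theta>"
    have "l \<in> tight_labels Lab \<theta> q v" if "l \<in> ?T v" for v l
      using m[OF that] dual_optimizer_tight_on_matching[OF feas _ _ q] by metis
    then show "q \<in> H"
      by (simp add: H_def tight_labels_def)
  qed
  moreover have "affine H"
    unfolding affine_def
  proof (intro ballI allI impI)
    fix q r and a b :: real
    assume qr: "q \<in> H" "r \<in> H" and ab: "a + b = 1"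
    have "fst (a *\<^sub>R q + b *\<^sub>R r) $ v + snd (a *\<^sub>R q + b *\<^sub>R r) $ l = \<theta> v l" if "l \<in> ?T v" for v l
    proof -
      have "fst (a *\<^sub>R q + b *\<^sub>R r) $ v + snd (a *\<^sub>R q + b *\<^sub>R r) $ l =
          a * (fst q $ v + snd q $ l) + b * (fst r $ v + snd r $ l)"
        by (simp add: algebra_simps)
      also have "\<dots> = (a + b) * \<theta> v l"
        using qr that by (simp add: H_def distrib_right)
      finally show ?thesis
        using ab by simp
    qed
    then show "a *\<^sub>R q + b *\<^sub>R r \<in> H"
      by (simp add: H_def)
  qed
  ultimately have hull: "affine hull (dual_optimizers Lab \<theta>) \<subseteq> H"
    by (rule hull_minimal)
  have "open U"
    unfolding U_def
    by (intro open_INT ballI finite open_Collect_less continuous_intros)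
  moreover have "p \<in> U"
    using feas by (auto simp: U_def tight_labels_def dual_feasible_iff order_less_le)
  moreover have "U \<inter> H \<subseteq> dual_optimizers Lab \<theta>"
  proof
    fix q assume q: "q \<in> U \<inter> H"
    have "fst q $ v + snd q $ l \<le> \<theta> v l" if "l \<in> Lab v" for v l
      using q that by (cases "l \<in> ?T v") (auto simp: U_def H_def intro: less_imp_le)
    then have "q \<in> dual_feasible Lab \<theta>"
      by (simp add: dual_feasible_iff)
    \<comment> \<open>Membership in \<open>H\<close> keeps the one matching \<open>y\<close> tight
      at \<open>q\<close>, which certifies that \<open>q\<close> is optimal.\<close>
    moreover have "y v \<in> tight_labels Lab \<theta> q v" for v
      using q y(2)[of v] by (simp add: H_def tight_labels_def)
    ultimately show "q \<in> dual_optimizers Lab \<theta>"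
      by (rule dual_optimal_if_tight_matching[OF _ y(1)])
  qed
  ultimately show ?thesis
    using p hull unfolding mem_rel_interior by blast
qed

theorem theorem2:
  fixes Lab :: "'v::finite \<Rightarrow> 'l::finite set"
    and \<theta> :: "'v \<Rightarrow> 'l \<Rightarrow> real"
    and \<alpha> :: "real ^ 'v"
    and \<beta> :: "real ^ 'l"
  assumes "CARD('v) = CARD('l)"
    and "lap_feasible Lab"
    and "(\<alpha>, \<beta>) \<in> dual_feasible Lab \<theta>"
  shows "((\<alpha>, \<beta>) \<in> dual_optimizers Lab \<theta> \<longleftrightarrow>
            (\<exists>x. perfect_matching (equality_edges Lab \<theta> \<alpha> \<beta>) x)) \<and>
         ((\<alpha>, \<beta>) \<in> rel_interior (dual_optimizers Lab \<theta>) \<longleftrightarrow>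
            (\<exists>x. perfect_matching (equality_edges Lab \<theta> \<alpha> \<beta>) x) \<and>
            (\<forall>e\<in>equality_edges Lab \<theta> \<alpha> \<beta>. perfectly_matchable (equality_edges Lab \<theta> \<alpha> \<beta>) e))"
proof -
  have optimal_iff: "(\<alpha>, \<beta>) \<in> dual_optimizers Lab \<theta> \<longleftrightarrow>
      (\<exists>x. perfect_matching (equality_edges Lab \<theta> \<alpha> \<beta>) x)"
    unfolding perfect_matching_equality_edges
    using dual_optimizer_tight_matching[OF assms(1)] dual_optimal_if_tight_matching[OF assms(3)]
    by blast
  have "(\<alpha>, \<beta>) \<in> rel_interior (dual_optimizers Lab \<theta>) \<longleftrightarrow>
      (\<exists>x. perfect_matching (equality_edges Lab \<theta> \<alpha> \<beta>) x) \<and>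
      (\<forall>e\<in>equality_edges Lab \<theta> \<alpha> \<beta>. perfectly_matchable (equality_edges Lab \<theta> \<alpha> \<beta>) e)"
    (is "?rel \<longleftrightarrow> ?pm \<and> ?matchable")
  proof
    assume rel: ?rel
    then have ?pm
      using rel_interior_subset optimal_iff by blast
    moreover have ?matchable
      unfolding all_perfectly_matchable_equality_edges
      using rel_interior_dual_optimizers_tight_matching[OF assms(1) rel] by blast
    ultimately show "?pm \<and> ?matchable"
      by blast
  next
    assume pm: "?pm \<and> ?matchable"
    then obtain y where "bij y" "\<And>v. y v \<in> tight_labels Lab \<theta> (\<alpha>, \<beta>) v"
      unfolding perfect_matching_equality_edges by blast
    moreover have "(\<alpha>, \<beta>) \<in> dual_optimizers Lab \<theta>"
      using pm optimal_iff by blast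
    ultimately show ?rel
      using pm rel_interior_dual_optimizers_if_matchable
      unfolding all_perfectly_matchable_equality_edges by blast
  qed
  with optimal_iff show ?thesis
    by blast
qed

end
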